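(* Let $a$ and $b$ be two nonnegative integers. Then the linear transformation $$y_n(q)=\sum_{k=0}^n\binom{a+n}{b+k}x_k(q)\qquad (n\ge 0)$$ preserves the strong $q$-log-concavity property: if $(x_k(q))_{k\ge 0}$ is a strongly $q$-log-concave sequence of polynomials in $q$ with nonnegative real coefficients, then $(y_n(q))_{n\ge 0}$ is strongly $q$-log-concave. In particular, it preserves the log-concavity property of sequences: if $(x_k)_{k\ge 0}$ is a log-concave sequence of nonnegative real numbers with no internal zeros, then the sequence $y_n=\sum_{k=0}^n\binom{a+n}{b+k}x_k$ ($n\ge 0$) is log-concave.
   Context: Here $\binom{m}{j}$ is the usual binomial coefficient, equal to $0$ when $j>m$. For polynomials $f,g$ in $q$ with real coefficients, $f(q)\geq_q g(q)$ means that $f(q)-g(q)$ has only nonnegative coefficients. A sequence $(f_n(q))_{n\ge 0}$ of polynomials with nonnegative coefficients is strongly $q$-log-concave if $f_n(q)f_m(q)\geq_q f_{n-1}(q)f_{m+1}(q)$ for all $m\ge n\ge 1$. A sequence $(a_n)_{n\ge0}$ of nonnegative real numbers has no internal zeros if $a_j\ne 0$ whenever $i<j<k$ and $a_ia_k\neq 0$; it is log-concave if $a_{k-1}a_{k+1}\le a_k^2$ for all $k\ge 1$. All sequences are assumed to have no internal zeros. *)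

theory Defs
  imports Complex_Main "HOL-Computational_Algebra.Polynomial"
begin

definition nonneg_coeffs :: "real poly \<Rightarrow> bool" where
  "nonneg_coeffs p \<longleftrightarrow> (\<forall>i. 0 \<le> coeff p i)"

definition q_ge :: "real poly \<Rightarrow> real poly \<Rightarrow> bool" (infix "\<ge>\<^sub>q" 50) where
  "f \<ge>\<^sub>q g \<longleftrightarrow> nonneg_coeffs (f - g)"

text \<open>For sequences of polynomials with nonnegative coefficients the inequalities below already
  exclude internal zeros: if the terms at positions \<open>i\<close> and \<open>k\<close> are nonzero and \<open>k \<ge> i + 2\<close>,
  then those at positions \<open>i + 1\<close> and \<open>k - 1\<close> are nonzero as well. Hence no separate
  condition is imposed.\<close>

definition strongly_q_log_concave :: "(nat \<Rightarrow> real poly) \<Rightarrow> bool" where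
  "strongly_q_log_concave f \<longleftrightarrow>
     (\<forall>n. nonneg_coeffs (f n)) \<and>
     (\<forall>n m. 1 \<le> n \<and> n \<le> m \<longrightarrow> f n * f m \<ge>\<^sub>q f (n - 1) * f (m + 1))"

definition no_internal_zeros :: "(nat \<Rightarrow> real) \<Rightarrow> bool" where
  "no_internal_zeros u \<longleftrightarrow>
     (\<forall>i j k. i < j \<and> j < k \<and> u i * u k \<noteq> 0 \<longrightarrow> u j \<noteq> 0)"

text \<open>Unlike in the polynomial case, the inequalities here do not exclude internal zeros.\<close>

definition log_concave :: "(nat \<Rightarrow> real) \<Rightarrow> bool" where
  "log_concave u \<longleftrightarrow>
     (\<forall>k. 0 \<le> u k) \<and> (\<forall>k\<ge>1. u (k - 1) * u (k + 1) \<le> (u k)\<^sup>2)"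

end

theory Submission
  imports Defs
begin

text \<open>
  For a strongly \<open>q\<close>-log-concave \<open>x\<close> the products \<open>x i * x j\<close> with \<open>i + j\<close> fixed grow as \<open>i\<close> and \<open>j\<close>
  approach each other. Summation by parts on each diagonal \<open>i + j = s\<close> therefore reduces the theorem
  to the sequences \<open>x k = z ^ k\<close> for \<open>k \<ge> r\<close> and \<open>x k = 0\<close> for \<open>k < r\<close>, and a shift of \<open>a\<close>, \<open>b\<close>, \<open>n\<close>
  by \<open>r\<close> further to \<open>r = 0\<close>. The rows \<open>T n = (\<Sum>k\<le>n. (a + n choose (b + k)) * z ^ k)\<close> satisfy
  \<open>T (n + 1) = (1 + z) * T n + u n + v n * z ^ (n + 1)\<close> with binomial coefficients \<open>u n\<close> and \<open>v n\<close>.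
  In \<open>T (n + 1) * T m - T n * T (m + 1)\<close> the terms with factor \<open>1 + z\<close> cancel, and the coefficients
  of the remainder are sums of \<open>2 \<times> 2\<close> minors of Pascal's triangle, which are nonnegative. The
  numerical statement is the case of constant polynomials.
\<close>

section \<open>Coefficientwise nonnegativity\<close>

lemma nonneg_coeffs_add: "nonneg_coeffs p \<Longrightarrow> nonneg_coeffs q \<Longrightarrow> nonneg_coeffs (p + q)"
  by (simp add: nonneg_coeffs_def)

lemma nonneg_coeffs_sum: "(\<And>i. i \<in> A \<Longrightarrow> nonneg_coeffs (f i)) \<Longrightarrow> nonneg_coeffs (\<Sum>i\<in>A. f i)"
  by (simp add: nonneg_coeffs_def coeff_sum sum_nonneg)

lemma nonneg_coeffs_mult: "nonneg_coeffs p \<Longrightarrow> nonneg_coeffs q \<Longrightarrow> nonneg_coeffs (p * q)"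
  by (simp add: nonneg_coeffs_def coeff_mult sum_nonneg)

lemma nonneg_coeffs_smult: "0 \<le> c \<Longrightarrow> nonneg_coeffs p \<Longrightarrow> nonneg_coeffs (smult c p)"
  by (simp add: nonneg_coeffs_def)

lemma nonneg_coeffs_monom: "0 \<le> c \<Longrightarrow> nonneg_coeffs (monom c k)"
  by (simp add: nonneg_coeffs_def)

lemma nonneg_coeffs_const [simp]: "nonneg_coeffs [:c:] \<longleftrightarrow> 0 \<le> c"
  by (auto simp add: nonneg_coeffs_def coeff_pCons split: nat.splits)

lemma smult_sum_distrib: "smult c (\<Sum>i\<in>A. f i) = (\<Sum>i\<in>A. smult c (f i))"
  by (induction A rule: infinite_finite_induct) (auto simp: smult_add_right)

section \<open>Minors of Pascal's triangle\<close>

text \<open>By absorption, \<open>(n + 1 - i) * (n + 1 choose i) = (n + 1) * (n choose i)\<close>.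
  Multiplied by \<open>(n + 1 - i) * (n + 1 - j)\<close>, the two sides therefore differ only in the
  factors \<open>n + 1 - j \<le> n + 1 - i\<close>.\<close>

lemma binomial_minor_Suc: "i \<le> j \<Longrightarrow> (n choose j) * (Suc n choose i) \<le> (n choose i) * (Suc n choose j)"
proof (cases "j \<le> n")
  case True
  assume ij: "i \<le> j"
  have "(Suc n - i) * (Suc n choose i) = Suc n * (n choose i)" for i
    by (metis binomial_absorb_comp diff_Suc_1)
  note e = this
  have "(Suc n - i) * (Suc n - j) * ((n choose j) * (Suc n choose i))
      = (n choose j) * (Suc n - j) * (Suc n * (n choose i))"
    using e[of i] by (metis mult.assoc mult.commute)
  also have "\<dots> \<le> (n choose j) * (Suc n - i) * (Suc n * (n choose i))"
    using ij by (intro mult_le_mono) auto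
  also have "\<dots> = (Suc n - i) * (Suc n - j) * ((n choose i) * (Suc n choose j))"
    using e[of j] by (metis (no_types, opaque_lifting) mult.assoc mult.commute)
  finally show ?thesis using True ij by simp
qed (simp add: binomial_eq_0)

text \<open>Minors of consecutive rows are chained; the factor \<open>m choose i\<close> cancels
  unless it is zero.\<close>

lemma binomial_minor:
  assumes "n \<le> m" "i \<le> j"
  shows "(n choose j) * (m choose i) \<le> (n choose i) * (m choose j)"
  using assms(1)
proof (induction m rule: dec_induct)
  case base
  then show ?case by (simp add: mult.commute)
next
  case (step m)
  show ?case
  proof (cases "m choose i = 0")
    case True
    then have "n < j"
      using step assms by (simp add: binomial_eq_0_iff)
    then show ?thesis by (simp add: binomial_eq_0)
  next
    case False
    have "(m choose i) * ((n choose j) * (Suc m choose i))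
        = ((n choose j) * (m choose i)) * (Suc m choose i)" by simp
    also have "\<dots> \<le> ((n choose i) * (m choose j)) * (Suc m choose i)"
      using step.IH by (rule mult_le_mono1)
    also have "\<dots> \<le> (n choose i) * ((m choose i) * (Suc m choose j))"
      using binomial_minor_Suc[OF assms(2), of m] by (simp add: mult.assoc)
    finally have "(m choose i) * ((n choose j) * (Suc m choose i))
        \<le> (m choose i) * ((n choose i) * (Suc m choose j))"
      by (simp add: ac_simps)
    then show ?thesis using False by simp
  qed
qed

text \<open>Reflecting both rows turns the columns into \<open>n - l \<le> n - k\<close>, now the
  same in both rows.\<close>

lemma binomial_minor_complement:
  assumes "k \<le> l"
  shows "(n + d choose (l + d)) * (n choose k) \<le> (n choose l) * (n + d choose (k + d))"
proof (cases "l \<le> n")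
  case True
  have "(n + d choose (l + d)) = (n + d choose (n - l))" "(n choose k) = (n choose (n - k))"
    "(n choose l) = (n choose (n - l))" "(n + d choose (k + d)) = (n + d choose (n - k))"
    using True assms binomial_symmetric[of "l + d" "n + d"] binomial_symmetric[of "k + d" "n + d"]
      binomial_symmetric[of k n] binomial_symmetric[of l n] by auto
  then show ?thesis
    using binomial_minor[of n "n + d" "n - l" "n - k"] assms by (simp add: mult.commute)
qed (simp add: binomial_eq_0)

section \<open>Transforms of geometric sequences\<close>

definition binomial_row :: "nat \<Rightarrow> nat \<Rightarrow> nat \<Rightarrow> real poly" where
  "binomial_row a b n = (\<Sum>k\<le>n. monom (real ((a + n) choose (b + k))) k)"

lemma coeff_binomial_row:
  "coeff (binomial_row a b n) k = (if k \<le> n then real ((a + n) choose (b + k)) else 0)"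
  by (simp add: binomial_row_def coeff_sum)

text \<open>This is \<open>a + n choose (b - 1)\<close>, with value \<open>0\<close> for the lower index \<open>- 1\<close>.\<close>

definition lower_boundary :: "nat \<Rightarrow> nat \<Rightarrow> nat \<Rightarrow> real" where
  "lower_boundary a b n = (if b = 0 then 0 else real ((a + n) choose (b - 1)))"

text \<open>Multiplication by \<open>1 + z\<close> is Pascal's rule except at the ends: degree
  \<open>0\<close> lacks column \<open>b - 1\<close>, and degree \<open>n + 1\<close> lacks column
  \<open>b + n + 1\<close>, which the truncation at \<open>n\<close> cut off.\<close>

lemma binomial_row_Suc:
  "binomial_row a b (Suc n) = [:1, 1:] * binomial_row a b n + [:lower_boundary a b n:]
     + monom (real ((a + n) choose (b + Suc n))) (Suc n)"
proof (rule poly_eqI)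
  fix k
  have "(Suc (a + n) choose (b + Suc k)) = (a + n choose (b + k)) + (a + n choose (b + Suc k))" for k
    by simp
  moreover have "(Suc (a + n) choose b) = (if b = 0 then 0 else a + n choose (b - 1)) + (a + n choose b)"
    by (cases b) auto
  ultimately show "coeff (binomial_row a b (Suc n)) k = coeff ([:1, 1:] * binomial_row a b n
     + [:lower_boundary a b n:] + monom (real ((a + n) choose (b + Suc n))) (Suc n)) k"
    by (cases k) (auto simp: coeff_binomial_row lower_boundary_def coeff_pCons not_less_eq_eq
        le_Suc_eq)
qed

lemma strongly_q_log_concave_binomial_row: "strongly_q_log_concave (binomial_row a b)"
  unfolding strongly_q_log_concave_def q_ge_def
proof (intro conjI allI impI)
  show nonneg: "nonneg_coeffs (binomial_row a b n)" for n
    by (simp add: nonneg_coeffs_def coeff_binomial_row)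
  fix n' m :: nat assume "1 \<le> n' \<and> n' \<le> m"
  then obtain n where n': "n' = Suc n" "Suc n \<le> m" by (cases n') auto
  define d where "d = m - n"
  have m: "m = n + d" using n' by (simp add: d_def)
  let ?T = "binomial_row a b" and ?u = "lower_boundary a b"
    and ?v = "\<lambda>n. real ((a + n) choose (b + Suc n))"
  have "?T (Suc n) * ?T m - ?T n * ?T (Suc m) =
      (smult (?u n) (?T m) - smult (?u m) (?T n))
    + (monom (?v n) (Suc n) * ?T m - monom (?v m) (Suc m) * ?T n)"
    by (simp add: binomial_row_Suc algebra_simps)
  moreover have "nonneg_coeffs (smult (?u n) (?T m) - smult (?u m) (?T n))"
    unfolding nonneg_coeffs_def
  proof
    fix k
    have "(a + n choose (b + k)) * (a + m choose (b - 1)) \<le> (a + n choose (b - 1)) * (a + m choose (b + k))"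
      using n' by (intro binomial_minor) auto
    from of_nat_mono[OF this, where 'a = real]
    show "0 \<le> coeff (smult (?u n) (?T m) - smult (?u m) (?T n)) k"
      using n' by (auto simp: lower_boundary_def coeff_binomial_row mult.commute)
  qed
  moreover have "nonneg_coeffs (monom (?v n) (Suc n) * ?T m - monom (?v m) (Suc m) * ?T n)"
    unfolding nonneg_coeffs_def
  proof
    fix i
    show "0 \<le> coeff (monom (?v n) (Suc n) * ?T m - monom (?v m) (Suc m) * ?T n) i"
    \<comment> \<open>Only at these degrees can the subtracted product contribute. For
      \<open>i = m + 1 + k\<close> the other product reads \<open>?T m\<close> at degree
      \<open>i - (n + 1) = k + d\<close>, hence the column shift by \<open>d\<close>.\<close>
    proof (cases "Suc m \<le> i \<and> i - Suc m \<le> n")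
      case True
      then obtain k where i: "i = Suc m + k" "k \<le> n" by (metis le_Suc_ex add_diff_cancel_left')
      have "(a + n + d choose (b + Suc n + d)) * (a + n choose (b + k))
          \<le> (a + n choose (b + Suc n)) * (a + n + d choose (b + k + d))"
        using i by (intro binomial_minor_complement) auto
      from of_nat_mono[OF this, where 'a = real]
      show ?thesis using i n'
        by (auto simp: m coeff_binomial_row coeff_monom_mult add_ac simp flip: of_nat_mult)
    next
      case False
      then show ?thesis by (auto simp: coeff_binomial_row coeff_monom_mult)
    qed
  qed
  ultimately show "nonneg_coeffs (?T n' * ?T m - ?T (n' - 1) * ?T (m + 1))"
    unfolding n' by (simp add: nonneg_coeffs_add)
qed

text \<open>For \<open>n \<ge> r\<close> the tail is \<open>z ^ r\<close> times row
  \<open>n - r\<close> with parameters \<open>a + r\<close> and \<open>b + r\<close>; for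
  \<open>n < r\<close> it is zero.\<close>

lemma strongly_q_log_concave_binomial_tail:
  "strongly_q_log_concave (\<lambda>n. \<Sum>k=r..n. monom (real ((a + n) choose (b + k))) k)"
proof -
  let ?A = "\<lambda>n. \<Sum>k=r..n. monom (real ((a + n) choose (b + k))) k"
  let ?T = "binomial_row (a + r) (b + r)"
  have A: "?A n = monom 1 r * ?T (n - r)" if "r \<le> n" for n
    by (rule poly_eqI)
      (use that in \<open>auto simp: coeff_sum coeff_monom_mult coeff_binomial_row algebra_simps\<close>)
  have A0: "?A n = 0" if "n < r" for n using that by simp
  have nonneg: "nonneg_coeffs (?A n)" for n
    by (intro nonneg_coeffs_sum nonneg_coeffs_monom) simp
  have "nonneg_coeffs (?A n * ?A m - ?A (n - 1) * ?A (m + 1))" if nm: "1 \<le> n" "n \<le> m" for n m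
  proof (cases "r < n")
    case True
    then have "?A n * ?A m - ?A (n - 1) * ?A (m + 1) = monom 1 r * monom 1 r *
        (?T (n - r) * ?T (m - r) - ?T (n - r - 1) * ?T (m - r + 1))"
      using nm by (subst (1 2 3 4) A) (auto simp: algebra_simps Suc_diff_le)
    moreover have "nonneg_coeffs (?T (n - r) * ?T (m - r) - ?T (n - r - 1) * ?T (m - r + 1))"
      using strongly_q_log_concave_binomial_row[of "a + r" "b + r"] True nm
      unfolding strongly_q_log_concave_def q_ge_def
      by (metis One_nat_def Suc_leI diff_le_mono zero_less_diff)
    ultimately show ?thesis
      by (simp only:) (intro nonneg_coeffs_mult nonneg_coeffs_monom; simp)
  next
    case False
    then have "?A (n - 1) = 0" using nm by (intro A0) auto
    then show ?thesis
      using nonneg_coeffs_mult[OF nonneg nonneg] by (simp only: mult_zero_left diff_zero)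
  qed
  then show ?thesis using nonneg unfolding strongly_q_log_concave_def q_ge_def by blast
qed

section \<open>Summation by parts along diagonals\<close>

text \<open>Each \<open>x k * x (s - k)\<close> is the sum of the increments with index up to the
  smaller of \<open>k\<close> and \<open>s - k\<close>. Exchanging the sums gives increment
  \<open>r\<close> the weight \<open>D r + ... + D (s - r)\<close>.\<close>

lemma nonneg_coeffs_diagonal:
  fixes D :: "nat \<Rightarrow> real"
  assumes x: "strongly_q_log_concave x"
    and D: "\<And>r. 2 * r \<le> s \<Longrightarrow> 0 \<le> (\<Sum>k=r..s-r. D k)"
  shows "nonneg_coeffs (\<Sum>k\<le>s. smult (D k) (x k * x (s - k)))"
proof -
  \<comment> \<open>The increments of \<open>x r * x (s - r)\<close> along the diagonal, nonnegative up to its middle.\<close>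
  define \<delta> where "\<delta> r = (if r = 0 then x 0 * x s else x r * x (s - r) - x (r - 1) * x (s - r + 1))" for r
  have \<delta>: "nonneg_coeffs (\<delta> r)" if "2 * r \<le> s" for r
    using x that unfolding \<delta>_def strongly_q_log_concave_def q_ge_def
    by (auto intro: nonneg_coeffs_mult)
  have tele: "(\<Sum>r\<le>k. \<delta> r) = x k * x (s - k)" if "k \<le> s" for k
    using that
  proof (induction k)
    case (Suc k)
    then have "s - Suc k + 1 = s - k" by simp
    with Suc show ?case by (simp add: \<delta>_def del: One_nat_def)
  qed (simp add: \<delta>_def)
  have "x k * x (s - k) = (\<Sum>r | 2 * r \<le> s \<and> k \<in> {r..s-r}. \<delta> r)" if k: "k \<le> s" for k
  proof (cases "2 * k \<le> s")
    case True
    then have "{r. 2 * r \<le> s \<and> k \<in> {r..s-r}} = {..k}" by auto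
    then show ?thesis using tele[OF k] by simp
  next
    case False
    then have "{r. 2 * r \<le> s \<and> k \<in> {r..s-r}} = {..s-k}" using k by auto
    then show ?thesis using tele[of "s - k"] k by (simp add: mult.commute)
  qed
  then have "(\<Sum>k\<le>s. smult (D k) (x k * x (s - k)))
      = (\<Sum>k\<le>s. \<Sum>r | r \<in> {r. 2 * r \<le> s} \<and> k \<in> {r..s-r}. smult (D k) (\<delta> r))"
    by (simp add: smult_sum_distrib)
  also have "\<dots> = (\<Sum>r | 2 * r \<le> s. \<Sum>k | k \<in> {..s} \<and> k \<in> {r..s-r}. smult (D k) (\<delta> r))"
    by (rule sum.swap_restrict) (auto intro: finite_subset[of _ "{..s}"])
  also have "\<dots> = (\<Sum>r | 2 * r \<le> s. smult (\<Sum>k=r..s-r. D k) (\<delta> r))"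
    by (auto simp: smult_sum intro!: sum.cong)
  finally show ?thesis using D \<delta>
    by (auto intro!: nonneg_coeffs_sum nonneg_coeffs_smult)
qed

text \<open>The weights required on diagonal \<open>s\<close> are the degree \<open>s\<close>
  coefficients of the inequalities assumed for the tails.\<close>

lemma strongly_q_log_concave_transform:
  fixes c :: "nat \<Rightarrow> nat \<Rightarrow> real"
  assumes c: "\<And>n k. k \<le> n \<Longrightarrow> 0 \<le> c n k"
    and tails: "\<And>r. strongly_q_log_concave (\<lambda>n. \<Sum>k=r..n. monom (c n k) k)"
    and x: "strongly_q_log_concave x"
  shows "strongly_q_log_concave (\<lambda>n. \<Sum>k=0..n. smult (c n k) (x k))"
proof -
  let ?y = "\<lambda>n. \<Sum>k=0..n. smult (c n k) (x k)"
  \<comment> \<open>Extension by zero lets every diagonal run over all \<open>k \<le> s\<close>; the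
    factor \<open>1 ^ k\<close> then makes \<open>?y n\<close> a polynomial evaluated at
    \<open>1\<close>, whose product formula groups by diagonals.\<close>
  define c0 where "c0 n k = (if k \<le> n then c n k else 0)" for n k
  have y: "?y n = (\<Sum>k\<le>n. smult (c0 n k) (x k) * 1 ^ k)" for n
    by (auto simp: c0_def atLeast0AtMost)
  have prod: "?y n * ?y m = (\<Sum>s\<le>n+m. \<Sum>k\<le>s. smult (c0 n k * c0 m (s - k)) (x k * x (s - k)))"
    for n m
    unfolding y
    by (subst polynomial_product) (auto simp: c0_def mult.commute intro!: sum.cong)
  have "nonneg_coeffs (?y n * ?y m - ?y (n - 1) * ?y (m + 1))" if nm: "1 \<le> n" "n \<le> m" for n m
  proof -
    let ?D = "\<lambda>s k. c0 n k * c0 m (s - k) - c0 (n - 1) k * c0 (m + 1) (s - k)"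
    have "?y n * ?y m - ?y (n - 1) * ?y (m + 1) =
       (\<Sum>s\<le>n+m. \<Sum>k\<le>s. smult (?D s k) (x k * x (s - k)))"
      using nm unfolding prod by (simp add: sum_subtractf smult_diff_left)
    moreover have "nonneg_coeffs (\<Sum>k\<le>s. smult (?D s k) (x k * x (s - k)))" for s
    proof (rule nonneg_coeffs_diagonal[OF x])
      fix r assume r: "2 * r \<le> s"
      let ?A = "\<lambda>n. \<Sum>k=r..n. monom (c n k) k"
      have A: "coeff (?A n) k = (if r \<le> k then c0 n k else 0)" for n k
        by (auto simp: coeff_sum c0_def)
      have AA: "coeff (?A n * ?A m) s = (\<Sum>k=r..s-r. c0 n k * c0 m (s - k))" for n m
        unfolding coeff_mult A
        by (rule sum.mono_neutral_cong_right) (use r in auto)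
      have "nonneg_coeffs (?A n * ?A m - ?A (n - 1) * ?A (m + 1))"
        using tails[of r] nm unfolding strongly_q_log_concave_def q_ge_def by blast
      then have "0 \<le> coeff (?A n * ?A m) s - coeff (?A (n - 1) * ?A (m + 1)) s"
        unfolding nonneg_coeffs_def coeff_diff by (rule spec)
      then show "0 \<le> (\<Sum>k=r..s-r. ?D s k)"
        unfolding AA by (simp add: sum_subtractf)
    qed
    ultimately show ?thesis by (simp only: nonneg_coeffs_sum)
  qed
  moreover have "nonneg_coeffs (?y n)" for n
    using c x by (intro nonneg_coeffs_sum nonneg_coeffs_smult) (auto simp: strongly_q_log_concave_def)
  ultimately show ?thesis unfolding strongly_q_log_concave_def q_ge_def by blast
qed

section \<open>Real sequences as constant polynomials\<close>

lemma strongly_q_log_concave_const_iff: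
  "strongly_q_log_concave (\<lambda>n. [:u n:]) \<longleftrightarrow> log_concave u \<and> no_internal_zeros u"
proof
  assume "strongly_q_log_concave (\<lambda>n. [:u n:])"
  then have nonneg: "0 \<le> u n" and lc: "1 \<le> n \<Longrightarrow> n \<le> m \<Longrightarrow> u (n - 1) * u (m + 1) \<le> u n * u m" for n m
    by (simp_all add: strongly_q_log_concave_def q_ge_def mult.commute)
      (metis mult.commute)
  have "log_concave u"
    using nonneg lc by (auto simp: log_concave_def power2_eq_square)
  moreover have "u j \<noteq> 0" if "i < j" "j < k" "u i * u k \<noteq> 0" for i j k
    using that
  \<comment> \<open>The nonzero ends \<open>i\<close> and \<open>k\<close> move inwards together
    until one of them meets \<open>j\<close>.\<close>
  proof (induction "k - i" arbitrary: i k rule: less_induct)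
    case less
    have "u i * u k \<le> u (i + 1) * u (k - 1)"
      using lc[of "i + 1" "k - 1"] less.prems by simp
    then have nz: "u (i + 1) * u (k - 1) \<noteq> 0"
      using less.prems nonneg[of i] nonneg[of k]
      by (metis mult_nonneg_nonneg order_antisym)
    consider "j = i + 1" | "j = k - 1" | "i + 1 < j \<and> j < k - 1"
      using less.prems by linarith
    then show ?case
    proof cases
      case 3
      show ?thesis
        by (rule less.hyps[of "k - 1" "i + 1"])
          (use less.prems 3 nz in auto)
    qed (use nz in auto)
  qed
  ultimately show "log_concave u \<and> no_internal_zeros u"
    unfolding no_internal_zeros_def by blast
next
  assume "log_concave u \<and> no_internal_zeros u"
  then have nonneg: "0 \<le> u k" and lc: "1 \<le> k \<Longrightarrow> u (k - 1) * u (k + 1) \<le> (u k)\<^sup>2"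
    and niz: "i < j \<Longrightarrow> j < k \<Longrightarrow> u j = 0 \<Longrightarrow> u i * u k = 0" for i j k
    unfolding log_concave_def no_internal_zeros_def by blast+
  have "u (n - 1) * u (m + 1) \<le> u n * u m" if "1 \<le> n" "n \<le> m" for n m
    using that(2)
  proof (induction m rule: dec_induct)
    case base
    show ?case using lc[of n] that(1) by (simp add: power2_eq_square)
  next
    case (step m)
    show ?case
    \<comment> \<open>The induction step divides by \<open>u (m + 1)\<close>; if that is zero, the
      absence of internal zeros makes the left-hand side vanish.\<close>
    proof (cases "u (m + 1) = 0")
      case True
      then have "u (n - 1) * u (m + 2) = 0" using step by (intro niz) auto
      then show ?thesis using nonneg by auto
    next
      case False
      have "u (m + 1) * (u (n - 1) * u (m + 2)) \<le> u n * u m * u (m + 2)"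
        using mult_right_mono[OF step.IH nonneg[of "m + 2"]] by (simp add: mult_ac)
      also have "\<dots> \<le> u n * (u (m + 1))\<^sup>2"
        using mult_left_mono[OF lc[of "m + 1"] nonneg[of n]] by (simp add: mult_ac)
      finally have "u (m + 1) * (u (n - 1) * u (m + 2)) \<le> u (m + 1) * (u n * u (m + 1))"
        by (simp add: power2_eq_square mult_ac)
      then show ?thesis using False nonneg[of "m + 1"] by simp
    qed
  qed
  then show "strongly_q_log_concave (\<lambda>n. [:u n:])"
    using nonneg by (simp add: strongly_q_log_concave_def q_ge_def mult.commute)
qed

theorem theorem1p1:
  fixes a b :: nat
  shows "(\<forall>x :: nat \<Rightarrow> real poly.
            strongly_q_log_concave x \<longrightarrow>
            strongly_q_log_concave
              (\<lambda>n. \<Sum>k=0..n. smult (real ((a + n) choose (b + k))) (x k))) \<and>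
         (\<forall>x :: nat \<Rightarrow> real.
            log_concave x \<and> no_internal_zeros x \<longrightarrow>
            log_concave (\<lambda>n. \<Sum>k=0..n. real ((a + n) choose (b + k)) * x k) \<and>
            no_internal_zeros (\<lambda>n. \<Sum>k=0..n. real ((a + n) choose (b + k)) * x k))"
proof -
  have main: "strongly_q_log_concave (\<lambda>n. \<Sum>k=0..n. smult (real ((a + n) choose (b + k))) (x k))"
    if "strongly_q_log_concave x" for x
    by (rule strongly_q_log_concave_transform[OF _ strongly_q_log_concave_binomial_tail that]) simp
  have const: "[:sum f A:] = (\<Sum>k\<in>A. [:f k:])" for f :: "nat \<Rightarrow> real" and A
    by (rule poly_eqI) (simp add: coeff_sum coeff_pCons split: nat.splits)
  show ?thesis
    \<comment> \<open>The equivalence for constants also returns the absence of internal zeros in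
      the image.\<close>
    using main main[of "\<lambda>k. [:x k:]" for x]
    by (auto simp: const simp flip: strongly_q_log_concave_const_iff)
qed

end
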